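(* Let $n\ge 1$ and let $\mathcal{H}$ denote Green's $\mathcal{H}$-relation on the multiplicative semigroup $(A^+(B_n),\circ)$. For $f,g\in A^+(B_n)$, $f\,\mathcal{H}\,g$ if and only if $\mathrm{Im}(f)=\mathrm{Im}(g)$ and $\mathrm{supp}(f)=\mathrm{supp}(g)$. Moreover, for $n\ge 2$, the number of $\mathcal{H}$-classes in $(A^+(B_n),\circ)$ is $n^4+2n^2+1$.
   Context: For $n\ge 1$ let $[n]=\{1,\dots,n\}$. The Brandt semigroup $(B_n,+)$ has underlying set $B_n=([n]\times[n])\cup\{\vartheta\}$ with $(i,j)+(k,l)=(i,l)$ if $j=k$, $(i,j)+(k,l)=\vartheta$ if $j\ne k$, and $\alpha+\vartheta=\vartheta+\alpha=\vartheta$ for all $\alpha\in B_n$. $M(B_n)$ is the set of all maps $B_n\to B_n$; arguments are written on the left of functions. It carries pointwise addition $\alpha(f+g)=\alpha f+\alpha g$ and composition $\alpha(f\circ g)=(\alpha f)g$ (so in $f\circ g$ the map $f$ is applied first). An affine map over $B_n$ is a map of the form $g+h$ with $g$ an endomorphism of the semigroup $(B_n,+)$ (not required to fix $\vartheta$) and $h\in M(B_n)$ a constant map. $A^+(B_n)$ (the affine near-semiring over $B_n$) is the smallest subset of $M(B_n)$ that contains all affine maps and is closed under $+$ and $\circ$. $\mathrm{Im}(f)=\{\alpha f:\alpha\in B_n\}$ and $\mathrm{supp}(f)=\{\alpha\in B_n : \alpha f\neq\vartheta\}$. *)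

theory Defs
  imports Main "HOL-Library.FuncSet"
begin

section \<open>Green's relations of a semigroup with carrier \<open>S\<close> and multiplication \<open>m\<close>\<close>

text \<open>
  The principal one-sided ideals are those of \<open>S\<close> with an identity adjoined, which is why the
  generator itself is inserted.
\<close>

definition principal_left_ideal :: "'a set \<Rightarrow> ('a \<Rightarrow> 'a \<Rightarrow> 'a) \<Rightarrow> 'a \<Rightarrow> 'a set" where
  "principal_left_ideal S m a = insert a {m s a | s. s \<in> S}"

definition principal_right_ideal :: "'a set \<Rightarrow> ('a \<Rightarrow> 'a \<Rightarrow> 'a) \<Rightarrow> 'a \<Rightarrow> 'a set" where
  "principal_right_ideal S m a = insert a {m a s | s. s \<in> S}"

definition green_L :: "'a set \<Rightarrow> ('a \<Rightarrow> 'a \<Rightarrow> 'a) \<Rightarrow> 'a rel" where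
  "green_L S m =
    {(a, b) \<in> S \<times> S. principal_left_ideal S m a = principal_left_ideal S m b}"

definition green_R :: "'a set \<Rightarrow> ('a \<Rightarrow> 'a \<Rightarrow> 'a) \<Rightarrow> 'a rel" where
  "green_R S m =
    {(a, b) \<in> S \<times> S. principal_right_ideal S m a = principal_right_ideal S m b}"

definition green_H :: "'a set \<Rightarrow> ('a \<Rightarrow> 'a \<Rightarrow> 'a) \<Rightarrow> 'a rel" where
  "green_H S m = green_L S m \<inter> green_R S m"


section \<open>The Brandt semigroup\<close>

text \<open>
  The addition does not mention \<open>n\<close>, so it is defined once on all pairs of naturals;
  \<open>brandt n\<close> is the underlying set of the Brandt semigroup of index \<open>n\<close>.
\<close>

datatype brandt_elem = Theta (\<open>\<vartheta>\<close>) | Pair_elem nat nat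

fun brandt_add :: "brandt_elem \<Rightarrow> brandt_elem \<Rightarrow> brandt_elem" (infixl \<open>+\<^sub>B\<close> 65) where
  "Pair_elem i j +\<^sub>B Pair_elem k l = (if j = k then Pair_elem i l else \<vartheta>)"
| "\<vartheta> +\<^sub>B \<beta> = \<vartheta>"
| "Pair_elem i j +\<^sub>B \<vartheta> = \<vartheta>"

definition brandt :: "nat \<Rightarrow> brandt_elem set" where
  "brandt n = {Pair_elem i j | i j. i \<in> {1..n} \<and> j \<in> {1..n}} \<union> {\<vartheta>}"


section \<open>Maps on the Brandt semigroup and the affine near-semiring\<close>

text \<open>
  Self-maps of \<open>brandt n\<close> are represented extensionally, i.e. with the fixed value
  \<^const>\<open>undefined\<close> outside \<open>brandt n\<close>, so that equality of HOL functions is equality of maps.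
\<close>

definition brandt_maps :: "nat \<Rightarrow> (brandt_elem \<Rightarrow> brandt_elem) set" where
  "brandt_maps n = brandt n \<rightarrow>\<^sub>E brandt n"

definition bmap_add ::
  "nat \<Rightarrow> (brandt_elem \<Rightarrow> brandt_elem) \<Rightarrow> (brandt_elem \<Rightarrow> brandt_elem)
    \<Rightarrow> brandt_elem \<Rightarrow> brandt_elem" where
  "bmap_add n f g = (\<lambda>\<alpha>\<in>brandt n. f \<alpha> +\<^sub>B g \<alpha>)"

text \<open>Arguments are written on the left of maps: in \<open>bmap_comp n f g\<close> the map \<open>f\<close> is applied first.\<close>

definition bmap_comp ::
  "nat \<Rightarrow> (brandt_elem \<Rightarrow> brandt_elem) \<Rightarrow> (brandt_elem \<Rightarrow> brandt_elem)
    \<Rightarrow> brandt_elem \<Rightarrow> brandt_elem" where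
  "bmap_comp n f g = compose (brandt n) g f"

definition endomorphisms :: "nat \<Rightarrow> (brandt_elem \<Rightarrow> brandt_elem) set" where
  "endomorphisms n =
    {g \<in> brandt_maps n. \<forall>\<alpha>\<in>brandt n. \<forall>\<beta>\<in>brandt n. g (\<alpha> +\<^sub>B \<beta>) = g \<alpha> +\<^sub>B g \<beta>}"

definition constant_maps :: "nat \<Rightarrow> (brandt_elem \<Rightarrow> brandt_elem) set" where
  "constant_maps n = {(\<lambda>\<alpha>\<in>brandt n. c) | c. c \<in> brandt n}"

definition affine_maps :: "nat \<Rightarrow> (brandt_elem \<Rightarrow> brandt_elem) set" where
  "affine_maps n = {bmap_add n g h | g h. g \<in> endomorphisms n \<and> h \<in> constant_maps n}"

inductive_set affine_nsr :: "nat \<Rightarrow> (brandt_elem \<Rightarrow> brandt_elem) set" for n :: nat where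
  affine: "f \<in> affine_maps n \<Longrightarrow> f \<in> affine_nsr n"
| add: "f \<in> affine_nsr n \<Longrightarrow> g \<in> affine_nsr n \<Longrightarrow> bmap_add n f g \<in> affine_nsr n"
| comp: "f \<in> affine_nsr n \<Longrightarrow> g \<in> affine_nsr n \<Longrightarrow> bmap_comp n f g \<in> affine_nsr n"

definition Im_map :: "nat \<Rightarrow> (brandt_elem \<Rightarrow> brandt_elem) \<Rightarrow> brandt_elem set" where
  "Im_map n f = f ` brandt n"

definition supp_map :: "nat \<Rightarrow> (brandt_elem \<Rightarrow> brandt_elem) \<Rightarrow> brandt_elem set" where
  "supp_map n f = {\<alpha> \<in> brandt n. f \<alpha> \<noteq> \<vartheta>}"

abbreviation H_rel :: "nat \<Rightarrow> (brandt_elem \<Rightarrow> brandt_elem) rel" where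
  "H_rel n \<equiv> green_H (affine_nsr n) (bmap_comp n)"

end

theory Submission imports Defs
begin

text \<open>
  An endomorphism of \<open>B\<^sub>n\<close> is constant or induced by a permutation of \<open>[n]\<close>. Hence \<open>A\<^sup>+(B\<^sub>n)\<close> consists
  of the constant maps, the maps supported on a single pair, and the maps \<open>(k, p; \<sigma>)\<close> sending
  \<open>(i, k)\<close> to \<open>(i\<sigma>, p)\<close> and everything else to \<open>\<vartheta>\<close>, with \<open>\<sigma>\<close> a permutation. Two
  maps \<open>(k, p; \<sigma>)\<close> and \<open>(k, p; \<tau>)\<close> are multiples of each other on either side, whereas a map of one of
  the first two kinds is determined by its image and support.
\<close>

section \<open>The elements of the affine near-semiring\<close>

lemma Pair_elem_in_brandt [simp]:
  "Pair_elem i j \<in> brandt n \<longleftrightarrow> i \<in> {1..n} \<and> j \<in> {1..n}"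
  by (auto simp: brandt_def)

lemma Theta_in_brandt [simp]: "\<vartheta> \<in> brandt n"
  by (simp add: brandt_def)

lemma brandt_add_Theta [simp]: "\<alpha> +\<^sub>B \<vartheta> = \<vartheta>"
  by (cases \<alpha>) auto

lemma brandt_add_closed: "\<alpha> \<in> brandt n \<Longrightarrow> \<beta> \<in> brandt n \<Longrightarrow> \<alpha> +\<^sub>B \<beta> \<in> brandt n"
  by (cases \<alpha>; cases \<beta>) auto

definition const_map :: "nat \<Rightarrow> brandt_elem \<Rightarrow> brandt_elem \<Rightarrow> brandt_elem" where
  "const_map n c = (\<lambda>\<alpha>\<in>brandt n. c)"

definition point_map :: "nat \<Rightarrow> brandt_elem \<Rightarrow> brandt_elem \<Rightarrow> brandt_elem \<Rightarrow> brandt_elem" where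
  "point_map n \<alpha> \<beta> = (\<lambda>x\<in>brandt n. if x = \<alpha> then \<beta> else \<vartheta>)"

text \<open>This is the shape of the sum of the automorphism induced by a permutation \<sigma> and
  the constant \<open>Pair_elem (\<sigma> k) p\<close>, which is why \<sigma> acts on the first
  coordinate only.\<close>

definition column_map ::
  "nat \<Rightarrow> nat \<Rightarrow> nat \<Rightarrow> (nat \<Rightarrow> nat) \<Rightarrow> brandt_elem \<Rightarrow> brandt_elem" where
  "column_map n k p \<sigma> = (\<lambda>x\<in>brandt n. case x of \<vartheta> \<Rightarrow> \<vartheta>
     | Pair_elem i j \<Rightarrow> if j = k then Pair_elem (\<sigma> i) p else \<vartheta>)"

definition pairs :: "nat \<Rightarrow> brandt_elem set" where
  "pairs n = brandt n - {\<vartheta>}"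

lemma pairs_cases:
  assumes "\<alpha> \<in> pairs n"
  obtains i j where "\<alpha> = Pair_elem i j" "i \<in> {1..n}" "j \<in> {1..n}"
  using assms by (cases \<alpha>) (auto simp: pairs_def)

lemma in_pairs [simp]: "Pair_elem i j \<in> pairs n \<longleftrightarrow> i \<in> {1..n} \<and> j \<in> {1..n}" "\<vartheta> \<notin> pairs n"
  by (auto simp: pairs_def)

lemma map_simps [simp]:
  "\<alpha> \<in> brandt n \<Longrightarrow> const_map n c \<alpha> = c"
  "\<alpha> \<in> brandt n \<Longrightarrow> point_map n \<beta> c \<alpha> = (if \<alpha> = \<beta> then c else \<vartheta>)"
  "column_map n k p \<sigma> \<vartheta> = \<vartheta>"
  "i \<in> {1..n} \<Longrightarrow> j \<in> {1..n} \<Longrightarrow>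
     column_map n k p \<sigma> (Pair_elem i j) = (if j = k then Pair_elem (\<sigma> i) p else \<vartheta>)"
  by (auto simp: const_map_def point_map_def column_map_def)

lemma map_extensional [simp]:
  "const_map n c \<in> extensional (brandt n)"
  "point_map n \<alpha> c \<in> extensional (brandt n)"
  "column_map n k p \<sigma> \<in> extensional (brandt n)"
  "bmap_add n f g \<in> extensional (brandt n)"
  "bmap_comp n f g \<in> extensional (brandt n)"
  by (auto simp: const_map_def point_map_def column_map_def bmap_add_def bmap_comp_def compose_def)

lemma bmap_simps [simp]:
  "\<alpha> \<in> brandt n \<Longrightarrow> bmap_add n f g \<alpha> = f \<alpha> +\<^sub>B g \<alpha>"
  "\<alpha> \<in> brandt n \<Longrightarrow> bmap_comp n f g \<alpha> = g (f \<alpha>)"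
  by (auto simp: bmap_add_def bmap_comp_def compose_def)

text \<open>Extensionality split by the shape of the argument, so that the evaluation rules above
  apply; most identities of maps below are proved this way.\<close>

lemma bmap_eqI:
  assumes "f \<in> extensional (brandt n)" "g \<in> extensional (brandt n)" "f \<vartheta> = g \<vartheta>"
    "\<And>i j. i \<in> {1..n} \<Longrightarrow> j \<in> {1..n} \<Longrightarrow> f (Pair_elem i j) = g (Pair_elem i j)"
  shows "f = g"
proof (rule extensionalityI[OF assms(1,2)])
  fix x assume "x \<in> brandt n"
  then show "f x = g x" using assms(3,4) by (cases x) auto
qed

section \<open>Normal forms of the elements of the near-semiring\<close>

text \<open>Points take nonzero values, so the zero map occurs only as a constant. For n = 1 the
  column map is also a point map; from n = 2 on the three families are disjoint.\<close>

inductive_set normal_forms :: "nat \<Rightarrow> (brandt_elem \<Rightarrow> brandt_elem) set" for n where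
  const: "c \<in> brandt n \<Longrightarrow> const_map n c \<in> normal_forms n"
| point: "\<alpha> \<in> pairs n \<Longrightarrow> \<beta> \<in> pairs n \<Longrightarrow> point_map n \<alpha> \<beta> \<in> normal_forms n"
| column: "k \<in> {1..n} \<Longrightarrow> p \<in> {1..n} \<Longrightarrow> bij_betw \<sigma> {1..n} {1..n} \<Longrightarrow>
    column_map n k p \<sigma> \<in> normal_forms n"

text \<open>Admits the value \<vartheta> as well, so that a sum or composite that may vanish at its
  only point needs no case distinction.\<close>

lemma point_map_normal:
  assumes "\<alpha> \<in> pairs n" "\<beta> \<in> brandt n"
  shows "point_map n \<alpha> \<beta> \<in> normal_forms n"
proof (cases "\<beta> = \<vartheta>")
  case True
  then have "point_map n \<alpha> \<beta> = const_map n \<vartheta>" by (auto intro!: bmap_eqI[where n = n])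
  then show ?thesis by (simp add: normal_forms.const)
next
  case False
  then show ?thesis using assms by (auto intro: normal_forms.point simp: pairs_def)
qed

lemma normal_forms_maps: "f \<in> normal_forms n \<Longrightarrow> f \<in> brandt_maps n"
  unfolding brandt_maps_def
proof (induction rule: normal_forms.induct)
  case (column k p \<sigma>)
  have "column_map n k p \<sigma> x \<in> brandt n" if "x \<in> brandt n" for x
    using that column by (cases x) (auto dest: bij_betwE)
  then show ?case by (simp add: PiE_def)
qed (auto simp: PiE_def pairs_def)

lemma normal_form_closed: "f \<in> normal_forms n \<Longrightarrow> x \<in> brandt n \<Longrightarrow> f x \<in> brandt n"
  using normal_forms_maps unfolding brandt_maps_def by blast

lemma normal_form_extensional: "f \<in> normal_forms n \<Longrightarrow> f \<in> extensional (brandt n)"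
  using normal_forms_maps unfolding brandt_maps_def by (blast dest: PiE_ext PiE_iff[THEN iffD1])

lemma pairs_nonTheta: "\<alpha> \<in> pairs n \<Longrightarrow> \<vartheta> \<noteq> \<alpha>"
  by auto

lemma pairs_brandt: "\<alpha> \<in> pairs n \<Longrightarrow> \<alpha> \<in> brandt n"
  by (simp add: pairs_def)

text \<open>The equivalence comes in both orientations because addition produces the equation either
  way round.\<close>

lemma bij_betw_preimage:
  assumes "bij_betw \<sigma> A B" "y \<in> B"
  obtains a where "a \<in> A" "\<forall>i\<in>A. \<sigma> i = y \<longleftrightarrow> i = a"
    "\<forall>i\<in>A. y = \<sigma> i \<longleftrightarrow> i = a"
proof -
  obtain a where "a \<in> A" "y = \<sigma> a"
    using assms unfolding bij_betw_def by blast
  then show thesis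
    using that[of a] inj_on_eq_iff[OF bij_betw_imp_inj_on[OF assms(1)]] by auto
qed

section \<open>Closure of the normal forms under pointwise addition\<close>

text \<open>Since \<vartheta> is absorbing, a sum with a point map can be nonzero only at that
  point.\<close>

lemma point_add:
  assumes "\<alpha> \<in> pairs n" "\<beta> \<in> brandt n" "f \<in> normal_forms n"
  shows "bmap_add n (point_map n \<alpha> \<beta>) f \<in> normal_forms n"
    "bmap_add n f (point_map n \<alpha> \<beta>) \<in> normal_forms n"
proof -
  have "bmap_add n (point_map n \<alpha> \<beta>) f = point_map n \<alpha> (\<beta> +\<^sub>B f \<alpha>)"
    "bmap_add n f (point_map n \<alpha> \<beta>) = point_map n \<alpha> (f \<alpha> +\<^sub>B \<beta>)"
    by (auto intro!: bmap_eqI[where n = n])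
  then show "bmap_add n (point_map n \<alpha> \<beta>) f \<in> normal_forms n"
    "bmap_add n f (point_map n \<alpha> \<beta>) \<in> normal_forms n"
    using assms normal_form_closed[OF assms(3)]
    by (simp_all add: point_map_normal brandt_add_closed pairs_brandt)
qed

text \<open>All nonzero values of the column map end in p, so adding (r, s) on the right either
  replaces p by s throughout or annihilates everything.\<close>

lemma column_add_const:
  assumes "k \<in> {1..n}" "p \<in> {1..n}" "bij_betw \<sigma> {1..n} {1..n}" "c \<in> brandt n"
  shows "bmap_add n (column_map n k p \<sigma>) (const_map n c) \<in> normal_forms n"
proof -
  have "bmap_add n (column_map n k p \<sigma>) (const_map n c) = (case c of \<vartheta> \<Rightarrow> const_map n \<vartheta>
      | Pair_elem r s \<Rightarrow> if p = r then column_map n k s \<sigma> else const_map n \<vartheta>)"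
    by (rule bmap_eqI[where n = n]) (auto split: brandt_elem.split)
  then show ?thesis
    using assms by (auto split: brandt_elem.split intro!: normal_forms.intros)
qed

text \<open>Adding (r, s) on the left keeps only the value whose first coordinate is s, and by
  bijectivity of \<sigma> exactly one argument has it.\<close>

lemma const_add_column:
  assumes "k \<in> {1..n}" "p \<in> {1..n}" "bij_betw \<sigma> {1..n} {1..n}" "c \<in> brandt n"
  shows "bmap_add n (const_map n c) (column_map n k p \<sigma>) \<in> normal_forms n"
proof (cases c)
  case Theta
  then have "bmap_add n (const_map n c) (column_map n k p \<sigma>) = const_map n \<vartheta>"
    by (auto intro!: bmap_eqI[where n = n])
  then show ?thesis by (simp add: normal_forms.const)
next
  case (Pair_elem r s)
  with assms(4) have "s \<in> {1..n}" by simp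
  with assms(3) obtain a where a: "a \<in> {1..n}" "\<forall>i\<in>{1..n}. \<sigma> i = s \<longleftrightarrow> i = a"
    "\<forall>i\<in>{1..n}. s = \<sigma> i \<longleftrightarrow> i = a"
    by (rule bij_betw_preimage)
  then have "bmap_add n (const_map n c) (column_map n k p \<sigma>)
      = point_map n (Pair_elem a k) (Pair_elem r p)"
    using Pair_elem a(3) by (intro bmap_eqI[where n = n]) simp_all
  then show ?thesis using assms a(1) Pair_elem by (simp add: normal_forms.point)
qed

text \<open>Different columns give disjoint supports. On a common column, (\<sigma> i, p) + (\<tau>
  i, p') is nonzero only if \<tau> i = p, which singles out one i.\<close>

lemma column_add_column:
  assumes "k \<in> {1..n}" "p \<in> {1..n}" "bij_betw \<sigma> {1..n} {1..n}"
    "k' \<in> {1..n}" "p' \<in> {1..n}" "bij_betw \<tau> {1..n} {1..n}"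
  shows "bmap_add n (column_map n k p \<sigma>) (column_map n k' p' \<tau>) \<in> normal_forms n"
proof (cases "k = k'")
  case False
  then have "bmap_add n (column_map n k p \<sigma>) (column_map n k' p' \<tau>) = const_map n \<vartheta>"
    by (auto intro!: bmap_eqI[where n = n])
  then show ?thesis by (simp add: normal_forms.const)
next
  case True
  obtain a where a: "a \<in> {1..n}" "\<forall>i\<in>{1..n}. \<tau> i = p \<longleftrightarrow> i = a"
    "\<forall>i\<in>{1..n}. p = \<tau> i \<longleftrightarrow> i = a"
    using assms(6,2) by (rule bij_betw_preimage)
  then have "bmap_add n (column_map n k p \<sigma>) (column_map n k' p' \<tau>)
      = point_map n (Pair_elem a k) (Pair_elem (\<sigma> a) p')"
    using True a(1,3) by (intro bmap_eqI[where n = n]) simp_all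
  moreover have "\<sigma> a \<in> {1..n}" using assms(3) a(1) by (rule bij_betw_apply)
  ultimately show ?thesis using assms a(1) by (simp add: normal_forms.point)
qed

lemma normal_forms_add:
  assumes "f \<in> normal_forms n" "g \<in> normal_forms n"
  shows "bmap_add n f g \<in> normal_forms n"
  using assms(1)
proof cases
  case f: (const c)
  show ?thesis using assms(2)
  proof cases
    case g: (const d)
    have "bmap_add n f g = const_map n (c +\<^sub>B d)" using f g by (auto intro!: bmap_eqI[where n = n])
    then show ?thesis using f g by (auto intro!: normal_forms.const brandt_add_closed)
  qed (use assms f in \<open>auto intro: point_add const_add_column pairs_brandt\<close>)
next
  case f: (column k p \<sigma>)
  show ?thesis using assms(2)
    by cases (use assms f in \<open>auto intro: point_add column_add_const column_add_column pairs_brandt\<close>)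
qed (use assms in \<open>auto intro: point_add pairs_brandt\<close>)

section \<open>Closure of the normal forms under composition\<close>

text \<open>The first map takes its nonzero values in column p and the second is nonzero only on
  column k'. So either nothing survives or the permutations compose, \<sigma> first.\<close>

lemma column_comp_column:
  "\<sigma> ` {1..n} \<subseteq> {1..n} \<Longrightarrow> p \<in> {1..n} \<Longrightarrow>
   bmap_comp n (column_map n k p \<sigma>) (column_map n k' p' \<tau>) =
     (if p = k' then column_map n k p' (\<tau> \<circ> \<sigma>) else const_map n \<vartheta>)"
  by (rule bmap_eqI[where n = n]) (auto simp: image_subset_iff)

text \<open>The column map reaches the point (r, s) only if s = p, and then from a single argument,
  given by the preimage of r under \<sigma>.\<close>

lemma column_comp_point:
  assumes "k \<in> {1..n}" "p \<in> {1..n}" "bij_betw \<sigma> {1..n} {1..n}" "\<alpha> \<in> pairs n" "\<beta> \<in> brandt n"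
  shows "bmap_comp n (column_map n k p \<sigma>) (point_map n \<alpha> \<beta>) \<in> normal_forms n"
proof -
  obtain r s where \<alpha>: "\<alpha> = Pair_elem r s" "r \<in> {1..n}" "s \<in> {1..n}"
    using assms(4) by (rule pairs_cases)
  obtain a where a: "a \<in> {1..n}" "\<forall>i\<in>{1..n}. \<sigma> i = r \<longleftrightarrow> i = a"
    "\<forall>i\<in>{1..n}. r = \<sigma> i \<longleftrightarrow> i = a"
    using assms(3) \<alpha>(2) by (rule bij_betw_preimage)
  have \<sigma>: "\<sigma> i \<in> {1..n}" if "i \<in> {1..n}" for i
    using assms(3) that by (rule bij_betw_apply)
  have "bmap_comp n (column_map n k p \<sigma>) (point_map n \<alpha> \<beta>)
      = (if p = s then point_map n (Pair_elem a k) \<beta> else const_map n \<vartheta>)"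
    using a(2) \<sigma> \<alpha> assms(1,2) by (intro bmap_eqI[where n = n]) auto
  then show ?thesis using assms a by (auto intro!: point_map_normal normal_forms.const)
qed

text \<open>The dichotomy behind composition: a second factor fixing \<vartheta> preserves the zeros
  of the first, and a constant one makes the composite constant.\<close>

lemma normal_forms_Theta:
  "f \<in> normal_forms n \<Longrightarrow> f \<vartheta> = \<vartheta> \<or> (\<exists>c\<in>brandt n. f = const_map n c)"
  by (erule normal_forms.cases) auto

lemma normal_forms_comp:
  assumes "f \<in> normal_forms n" "g \<in> normal_forms n"
  shows "bmap_comp n f g \<in> normal_forms n"
proof (cases "\<exists>c\<in>brandt n. g = const_map n c")
  case True
  then obtain c where c: "c \<in> brandt n" "g = const_map n c" by blast
  have "bmap_comp n f g = const_map n c"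
    using c normal_form_closed[OF assms(1)] by (auto intro!: bmap_eqI[where n = n])
  then show ?thesis using c by (simp add: normal_forms.const)
next
  case False
  with normal_forms_Theta[OF assms(2)] have g0: "g \<vartheta> = \<vartheta>" by blast
  show ?thesis using assms(1)
  proof cases
    case (const c)
    then have "bmap_comp n f g = const_map n (g c)" by (auto intro!: bmap_eqI[where n = n])
    then show ?thesis using const normal_form_closed[OF assms(2)]
      by (simp add: normal_forms.const)
  next
    case (point \<alpha> \<beta>)
    then have "bmap_comp n f g = point_map n \<alpha> (g \<beta>)" using g0 by (auto intro!: bmap_eqI[where n = n])
    then show ?thesis
      using point normal_form_closed[OF assms(2)] by (simp add: point_map_normal pairs_brandt)
  next
    case f: (column k p \<sigma>)
    show ?thesis using assms(2)
    proof cases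
      case (const c)
      then show ?thesis using False by blast
    next
      case (point \<alpha> \<beta>)
      then show ?thesis using f by (simp add: column_comp_point pairs_brandt)
    next
      case g: (column k' p' \<tau>)
      then have "bij_betw (\<tau> \<circ> \<sigma>) {1..n} {1..n}" using f bij_betw_trans by blast
      moreover have "\<sigma> ` {1..n} \<subseteq> {1..n}" using f by (simp add: bij_betw_def)
      ultimately show ?thesis using f g
        by (simp add: column_comp_column normal_forms.column normal_forms.const)
    qed
  qed
qed

section \<open>Endomorphisms and affine maps\<close>

lemma brandt_add_eq_idem: "x +\<^sub>B Pair_elem a a = Pair_elem a a \<Longrightarrow> x = Pair_elem a a"
  by (cases x) (auto split: if_splits)

lemma brandt_idem: "x +\<^sub>B x = x \<Longrightarrow> x \<noteq> \<vartheta> \<Longrightarrow> \<exists>a. x = Pair_elem a a"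
  by (cases x) (auto split: if_splits)

text \<open>The image of \<vartheta> is idempotent. If it is some (a, a), then x + \<vartheta> =
  \<vartheta> forces every value to be (a, a). If \<vartheta> is fixed, either every pair is sent to
  \<vartheta> or none is; in the latter case the idempotents (i, i) are permuted, and this
  determines the map.\<close>

lemma endomorphism_cases:
  assumes "g \<in> endomorphisms n"
  obtains (const) c where "c \<in> brandt n" "g = const_map n c"
    | (perm) \<sigma> where "bij_betw \<sigma> {1..n} {1..n}" "g \<vartheta> = \<vartheta>"
        "\<And>i j. i \<in> {1..n} \<Longrightarrow> j \<in> {1..n} \<Longrightarrow> g (Pair_elem i j) = Pair_elem (\<sigma> i) (\<sigma> j)"
proof -
  have hom: "g (\<alpha> +\<^sub>B \<beta>) = g \<alpha> +\<^sub>B g \<beta>" if "\<alpha> \<in> brandt n" "\<beta> \<in> brandt n" for \<alpha> \<beta>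
    using assms that by (auto simp: endomorphisms_def)
  have ext: "g \<in> extensional (brandt n)" and cl: "\<And>x. x \<in> brandt n \<Longrightarrow> g x \<in> brandt n"
    using assms by (auto simp: endomorphisms_def brandt_maps_def PiE_def)
  show thesis
  proof (cases "g \<vartheta> = \<vartheta>")
    case False
    then obtain a where a: "g \<vartheta> = Pair_elem a a"
      using hom[of \<vartheta> \<vartheta>] brandt_idem[of "g \<vartheta>"] by auto
    have "g x = Pair_elem a a" if "x \<in> brandt n" for x
      using hom[OF that Theta_in_brandt] a brandt_add_eq_idem[of "g x"] by simp
    then have "g = const_map n (Pair_elem a a)" using ext by (intro bmap_eqI[where n = n]) auto
    then show thesis using const[of "Pair_elem a a"] cl[of \<vartheta>] a by simp
  next
    case g0: True
    show thesis
    proof (cases "\<exists>i\<in>{1..n}. \<exists>j\<in>{1..n}. g (Pair_elem i j) = \<vartheta>")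
      case True
      then obtain i j where ij: "i \<in> {1..n}" "j \<in> {1..n}" "g (Pair_elem i j) = \<vartheta>" by blast
      \<comment> \<open>The factorisation (k, l) = (k, i) + (i, j) + (j, l) spreads the zero value
        to every pair.\<close>
      have "g (Pair_elem k l) = \<vartheta>" if "k \<in> {1..n}" "l \<in> {1..n}" for k l
        using hom[of "Pair_elem k i" "Pair_elem i l"] hom[of "Pair_elem i j" "Pair_elem j l"] that ij
        by simp
      then have "g = const_map n \<vartheta>" using ext g0 by (intro bmap_eqI[where n = n]) auto
      then show thesis using const[of \<vartheta>] by simp
    next
      case False
      have "\<exists>a. g (Pair_elem i i) = Pair_elem a a" if "i \<in> {1..n}" for i
        using hom[of "Pair_elem i i" "Pair_elem i i"] that False brandt_idem by simp
      then obtain \<sigma> where \<sigma>: "\<And>i. i \<in> {1..n} \<Longrightarrow> g (Pair_elem i i) = Pair_elem (\<sigma> i) (\<sigma> i)"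
        by metis
      have "g (Pair_elem i j) = Pair_elem (\<sigma> i) (\<sigma> j)" if "i \<in> {1..n}" "j \<in> {1..n}" for i j
      proof -
        have "g (Pair_elem i j) \<noteq> \<vartheta>" using that False by blast
        then obtain a b where ab: "g (Pair_elem i j) = Pair_elem a b"
          by (cases "g (Pair_elem i j)") auto
        \<comment> \<open>One-sided identities of (i, j) are mapped to one-sided identities of its
          image, whose coordinates they fix.\<close>
        have "Pair_elem i j = Pair_elem i i +\<^sub>B Pair_elem i j"
          "Pair_elem i j = Pair_elem i j +\<^sub>B Pair_elem j j" by simp_all
        with hom[of "Pair_elem i i" "Pair_elem i j"] hom[of "Pair_elem i j" "Pair_elem j j"]
        have "Pair_elem a b = Pair_elem (\<sigma> i) (\<sigma> i) +\<^sub>B Pair_elem a b"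
          "Pair_elem a b = Pair_elem a b +\<^sub>B Pair_elem (\<sigma> j) (\<sigma> j)"
          using that ab \<sigma> by (metis Pair_elem_in_brandt)+
        then have "\<sigma> i = a" "b = \<sigma> j"
          by (metis brandt_add.simps(1) brandt_elem.distinct(1))+
        then show ?thesis using ab by simp
      qed
      moreover have "inj_on \<sigma> {1..n}"
      proof (rule inj_onI, rule ccontr)
        fix i j assume "i \<in> {1..n}" "j \<in> {1..n}" "\<sigma> i = \<sigma> j" "i \<noteq> j"
        \<comment> \<open>Distinct idempotents add up to \<vartheta>, whereas a common nonzero image
          would add up to itself.\<close>
        then show False using hom[of "Pair_elem i i" "Pair_elem j j"] \<sigma> g0 by simp
      qed
      moreover have "\<sigma> ` {1..n} \<subseteq> {1..n}"
      proof
        fix x assume "x \<in> \<sigma> ` {1..n}"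
        then obtain i where i: "i \<in> {1..n}" "x = \<sigma> i" by blast
        then show "x \<in> {1..n}" using cl[of "Pair_elem i i"] \<sigma>[of i] by simp
      qed
      ultimately show thesis using perm[of \<sigma>] g0 endo_inj_surj[of "{1..n}" \<sigma>]
        by (simp add: bij_betw_def)
    qed
  qed
qed

text \<open>For a permutation endomorphism, (\<sigma> i, \<sigma> j) + (r, s) is nonzero exactly
  when \<sigma> j = r. This selects the column indexed by the preimage of r.\<close>

lemma affine_map_normal:
  assumes "f \<in> affine_maps n"
  shows "f \<in> normal_forms n"
proof -
  obtain g c where g: "g \<in> endomorphisms n" and c: "c \<in> brandt n"
    and f: "f = bmap_add n g (const_map n c)"
    using assms by (auto simp: affine_maps_def constant_maps_def const_map_def)
  from g show ?thesis
  proof (cases rule: endomorphism_cases)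
    case (const d)
    then show ?thesis using f c by (auto intro!: normal_forms_add normal_forms.const)
  next
    case (perm \<sigma>)
    show ?thesis
    proof (cases c)
      case Theta
      then have "f = const_map n \<vartheta>" using f by (auto intro!: bmap_eqI[where n = n])
      then show ?thesis by (simp add: normal_forms.const)
    next
      case (Pair_elem r s)
      with c have "r \<in> {1..n}" by simp
      with perm(1) obtain k where k: "k \<in> {1..n}"
        "\<forall>j\<in>{1..n}. \<sigma> j = r \<longleftrightarrow> j = k" "\<forall>j\<in>{1..n}. r = \<sigma> j \<longleftrightarrow> j = k"
        by (rule bij_betw_preimage)
      from k(2) have "f = column_map n k s \<sigma>" using f perm Pair_elem by (auto intro!: bmap_eqI[where n = n])
      then show ?thesis using k perm(1) c Pair_elem by (auto intro!: normal_forms.column)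
    qed
  qed
qed

section \<open>Generating every normal form from affine maps\<close>

text \<open>Every c has an idempotent left identity d, and the constant map at an idempotent is an
  endomorphism, since endomorphisms may move \<vartheta>.\<close>

lemma const_map_affine:
  assumes "c \<in> brandt n"
  shows "const_map n c \<in> affine_maps n"
proof -
  have idem: "const_map n d \<in> endomorphisms n" if "d \<in> brandt n" "d +\<^sub>B d = d" for d
    using that by (auto simp: endomorphisms_def brandt_maps_def PiE_def brandt_add_closed)
  obtain d where d: "d \<in> brandt n" "d +\<^sub>B d = d" "d +\<^sub>B c = c"
  proof (cases c)
    case (Pair_elem r s)
    then show thesis using that[of "Pair_elem r r"] assms by simp
  qed (use that[of \<vartheta>] in simp)
  have "const_map n c = bmap_add n (const_map n d) (const_map n c)"
    using d by (auto intro!: bmap_eqI[where n = n])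
  then show ?thesis using idem[OF d(1,2)] assms
    unfolding affine_maps_def constant_maps_def const_map_def by blast
qed

text \<open>Adding the constant (\<sigma> k, p) to the automorphism induced by \<sigma> leaves a
  nonzero value only where \<sigma> j = \<sigma> k, that is, j = k.\<close>

lemma column_map_affine:
  assumes "k \<in> {1..n}" "p \<in> {1..n}" "bij_betw \<sigma> {1..n} {1..n}"
  shows "column_map n k p \<sigma> \<in> affine_maps n"
proof -
  define g where "g = (\<lambda>x\<in>brandt n. case x of \<vartheta> \<Rightarrow> \<vartheta> | Pair_elem i j \<Rightarrow> Pair_elem (\<sigma> i) (\<sigma> j))"
  have \<sigma>: "\<sigma> i \<in> {1..n}" if "i \<in> {1..n}" for i
    using assms(3) that by (rule bij_betw_apply)
  have inj: "\<sigma> i = \<sigma> j \<longleftrightarrow> i = j" if "i \<in> {1..n}" "j \<in> {1..n}" for i j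
    using bij_betw_imp_inj_on[OF assms(3)] that by (rule inj_on_eq_iff)
  have [simp]: "g \<vartheta> = \<vartheta>" "i \<in> {1..n} \<Longrightarrow> j \<in> {1..n} \<Longrightarrow> g (Pair_elem i j) = Pair_elem (\<sigma> i) (\<sigma> j)"
    for i j by (auto simp: g_def)
  have "g \<in> extensional (brandt n)" by (simp add: g_def)
  moreover have "g x \<in> brandt n" if "x \<in> brandt n" for x
    using that \<sigma> by (cases x) auto
  moreover have "g (x +\<^sub>B y) = g x +\<^sub>B g y" if "x \<in> brandt n" "y \<in> brandt n" for x y
    using that inj by (cases x; cases y) auto
  ultimately have "g \<in> endomorphisms n"
    by (simp add: endomorphisms_def brandt_maps_def PiE_def)
  moreover have "column_map n k p \<sigma> = bmap_add n g (const_map n (Pair_elem (\<sigma> k) p))"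
    using \<sigma> inj assms(1) by (auto intro!: bmap_eqI[where n = n])
  moreover have "Pair_elem (\<sigma> k) p \<in> brandt n" using \<sigma> assms(1,2) by simp
  ultimately show ?thesis
    unfolding affine_maps_def constant_maps_def const_map_def by blast
qed

text \<open>Adding the constant (r, a) on the left of the column map that sends (i, b) to (i, q)
  keeps only i = a, with value (r, q).\<close>

lemma point_map_affine_nsr:
  assumes "\<alpha> \<in> pairs n" "\<beta> \<in> pairs n"
  shows "point_map n \<alpha> \<beta> \<in> affine_nsr n"
proof -
  obtain a b where \<alpha>: "\<alpha> = Pair_elem a b" "a \<in> {1..n}" "b \<in> {1..n}"
    using assms(1) by (rule pairs_cases)
  obtain r q where \<beta>: "\<beta> = Pair_elem r q" "r \<in> {1..n}" "q \<in> {1..n}"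
    using assms(2) by (rule pairs_cases)
  have "point_map n \<alpha> \<beta> = bmap_add n (const_map n (Pair_elem r a)) (column_map n b q id)"
    using \<alpha> \<beta> by (auto intro!: bmap_eqI[where n = n])
  then show ?thesis using \<alpha> \<beta>
    by (simp add: affine_nsr.add affine_nsr.affine const_map_affine column_map_affine)
qed

text \<open>The normal forms contain the affine maps and are closed under both operations;
  conversely, each is affine or a sum of two affine maps.\<close>

lemma affine_nsr_eq_normal_forms: "affine_nsr n = normal_forms n"
proof (intro equalityI subsetI)
  fix f assume "f \<in> affine_nsr n"
  then show "f \<in> normal_forms n"
    by induction (auto intro: affine_map_normal normal_forms_add normal_forms_comp)
next
  fix f assume "f \<in> normal_forms n"
  then show "f \<in> affine_nsr n"
    by induction
      (blast intro: affine_nsr.affine const_map_affine column_map_affine point_map_affine_nsr)+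
qed


section \<open>Green's relation H\<close>

lemma Im_supp_simps [simp]:
  "Im_map n (const_map n c) = {c}"
  "supp_map n (const_map n c) = (if c = \<vartheta> then {} else brandt n)"
proof -
  have "brandt n \<noteq> {}" using Theta_in_brandt by blast
  then show "Im_map n (const_map n c) = {c}" by (auto simp: Im_map_def)
qed (auto simp: supp_map_def)

lemma Im_supp_point:
  assumes "\<alpha> \<in> pairs n" "\<beta> \<in> pairs n"
  shows "Im_map n (point_map n \<alpha> \<beta>) = {\<vartheta>, \<beta>}" "supp_map n (point_map n \<alpha> \<beta>) = {\<alpha>}"
proof -
  have ne: "\<vartheta> \<noteq> \<alpha>" "\<vartheta> \<noteq> \<beta>" "\<alpha> \<in> brandt n"
    using assms pairs_nonTheta pairs_brandt by blast+
  have "\<vartheta> \<in> Im_map n (point_map n \<alpha> \<beta>)" "\<beta> \<in> Im_map n (point_map n \<alpha> \<beta>)"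
    unfolding Im_map_def using ne by (auto intro: image_eqI[of _ _ \<vartheta>] image_eqI[of _ _ \<alpha>])
  moreover have "Im_map n (point_map n \<alpha> \<beta>) \<subseteq> {\<vartheta>, \<beta>}"
    by (auto simp: Im_map_def)
  ultimately show "Im_map n (point_map n \<alpha> \<beta>) = {\<vartheta>, \<beta>}" by blast
  show "supp_map n (point_map n \<alpha> \<beta>) = {\<alpha>}"
    using ne by (auto simp: supp_map_def split: if_splits)
qed

text \<open>Permuting first coordinates leaves a column unchanged, so \<sigma> disappears: the image
  records p and the support records k.\<close>

lemma Im_supp_column:
  assumes "k \<in> {1..n}" "p \<in> {1..n}" "bij_betw \<sigma> {1..n} {1..n}"
  shows "Im_map n (column_map n k p \<sigma>) = insert \<vartheta> ((\<lambda>i. Pair_elem i p) ` {1..n})"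
    "supp_map n (column_map n k p \<sigma>) = (\<lambda>i. Pair_elem i k) ` {1..n}"
proof -
  have br: "brandt n = insert \<vartheta> (case_prod Pair_elem ` ({1..n} \<times> {1..n}))"
    by (auto simp: brandt_def)
  have "Im_map n (column_map n k p \<sigma>) = insert \<vartheta> ((\<lambda>i. Pair_elem (\<sigma> i) p) ` {1..n})"
    using assms(1) unfolding Im_map_def br by (force simp: image_iff)
  also have "(\<lambda>i. Pair_elem (\<sigma> i) p) ` {1..n} = (\<lambda>i. Pair_elem i p) ` \<sigma> ` {1..n}"
    by (simp add: image_image)
  finally show "Im_map n (column_map n k p \<sigma>) = insert \<vartheta> ((\<lambda>i. Pair_elem i p) ` {1..n})"
    using assms(3) by (simp add: bij_betw_def)
  show "supp_map n (column_map n k p \<sigma>) = (\<lambda>i. Pair_elem i k) ` {1..n}"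
    using assms(1) unfolding supp_map_def br by (auto simp: image_iff split: if_splits)
qed

lemma Im_singleton_imp_eq:
  assumes "Im_map n f = {c}" "f \<in> extensional (brandt n)"
  shows "f = const_map n c"
proof -
  have "f x = c" if "x \<in> brandt n" for x
    using assms(1) that by (auto simp: Im_map_def)
  then show ?thesis using assms(2) by (intro bmap_eqI[where n = n]) auto
qed

text \<open>The support makes f vanish off \<alpha>, and at \<alpha> the only value left in the
  image is \<beta>.\<close>

lemma point_map_unique:
  assumes "Im_map n f = {\<vartheta>, \<beta>}" "supp_map n f = {\<alpha>}" "f \<in> extensional (brandt n)"
  shows "f = point_map n \<alpha> \<beta>"
proof (rule extensionalityI[OF assms(3)])
  fix x assume x: "x \<in> brandt n"
  have "f \<alpha> \<noteq> \<vartheta>" "\<alpha> \<in> brandt n" using assms(2) by (auto simp: supp_map_def)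
  then show "f x = point_map n \<alpha> \<beta> x" using x assms(1,2) by (auto simp: supp_map_def Im_map_def)
qed simp

section \<open>Green's relations as mutual divisibility\<close>

text \<open>A left factor is applied first, so it can only restrict the arguments that reach
  f.\<close>

lemma Im_map_comp:
  "s \<in> brandt_maps n \<Longrightarrow> Im_map n (bmap_comp n s f) \<subseteq> Im_map n f"
  by (auto simp: Im_map_def brandt_maps_def)

lemma bmap_comp_assoc:
  "f \<in> brandt_maps n \<Longrightarrow> bmap_comp n (bmap_comp n f g) h = bmap_comp n f (bmap_comp n g h)"
  by (auto simp: bmap_comp_def compose_def brandt_maps_def fun_eq_iff PiE_def Pi_def)

text \<open>The case f = g reflects the adjoined identity. The multiplication is kept abstract so
  that the dual statement follows by reversing it.\<close>

lemma green_L_iff: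
  assumes "\<And>a b c. a \<in> S \<Longrightarrow> b \<in> S \<Longrightarrow> c \<in> S \<Longrightarrow> m (m a b) c = m a (m b c)"
    "\<And>a b. a \<in> S \<Longrightarrow> b \<in> S \<Longrightarrow> m a b \<in> S" "f \<in> S" "g \<in> S"
  shows "(f, g) \<in> green_L S m \<longleftrightarrow> f = g \<or> (\<exists>s\<in>S. \<exists>t\<in>S. f = m s g \<and> g = m t f)"
proof
  assume "(f, g) \<in> green_L S m"
  then have "f \<in> principal_left_ideal S m g" "g \<in> principal_left_ideal S m f"
    by (auto simp: green_L_def principal_left_ideal_def)
  then show "f = g \<or> (\<exists>s\<in>S. \<exists>t\<in>S. f = m s g \<and> g = m t f)"
    by (auto simp: principal_left_ideal_def)
next
  assume r: "f = g \<or> (\<exists>s\<in>S. \<exists>t\<in>S. f = m s g \<and> g = m t f)"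
  \<comment> \<open>By associativity, a left multiple of s b is a left multiple of b.\<close>
  have "principal_left_ideal S m a \<subseteq> principal_left_ideal S m b"
    if "s \<in> S" "b \<in> S" "a = m s b" for a b s
    using that assms(1,2) unfolding principal_left_ideal_def by force
  with r assms(3,4) show "(f, g) \<in> green_L S m"
    unfolding green_L_def by blast
qed

text \<open>The R-relation is the L-relation of the opposite multiplication.\<close>

lemma green_R_iff:
  assumes "\<And>a b c. a \<in> S \<Longrightarrow> b \<in> S \<Longrightarrow> c \<in> S \<Longrightarrow> m (m a b) c = m a (m b c)"
    "\<And>a b. a \<in> S \<Longrightarrow> b \<in> S \<Longrightarrow> m a b \<in> S" "f \<in> S" "g \<in> S"
  shows "(f, g) \<in> green_R S m \<longleftrightarrow> f = g \<or> (\<exists>s\<in>S. \<exists>t\<in>S. f = m g s \<and> g = m f t)"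
proof -
  have "green_R S m = green_L S (\<lambda>a b. m b a)"
    by (simp add: green_R_def green_L_def principal_left_ideal_def principal_right_ideal_def)
  then show ?thesis using green_L_iff[of S "\<lambda>a b. m b a" f g] assms by simp
qed

lemma green_affine_iff:
  assumes "f \<in> normal_forms n" "g \<in> normal_forms n"
  shows "(f, g) \<in> green_L (affine_nsr n) (bmap_comp n) \<longleftrightarrow>
      f = g \<or> (\<exists>s\<in>normal_forms n. \<exists>t\<in>normal_forms n. f = bmap_comp n s g \<and> g = bmap_comp n t f)"
    "(f, g) \<in> green_R (affine_nsr n) (bmap_comp n) \<longleftrightarrow>
      f = g \<or> (\<exists>s\<in>normal_forms n. \<exists>t\<in>normal_forms n. f = bmap_comp n g s \<and> g = bmap_comp n f t)"
  unfolding affine_nsr_eq_normal_forms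
  by (rule green_L_iff green_R_iff;
      simp add: assms bmap_comp_assoc normal_forms_comp normal_forms_maps)+

text \<open>A constant s would make f constant, so s fixes \<vartheta> and every zero of g remains a
  zero of f.\<close>

lemma right_multiple_supp:
  assumes "g \<in> normal_forms n" "s \<in> normal_forms n" "f = bmap_comp n g s"
    "\<And>c. f \<noteq> const_map n c"
  shows "supp_map n f \<subseteq> supp_map n g"
proof -
  have "s \<noteq> const_map n c" for c
  proof
    assume "s = const_map n c"
    then have "f = const_map n c"
      using assms(3) normal_form_closed[OF assms(1)] by (auto intro!: bmap_eqI[where n = n])
    then show False using assms(4) by blast
  qed
  then have "s \<vartheta> = \<vartheta>" using normal_forms_Theta[OF assms(2)] by blast
  then show ?thesis using assms(3) by (auto simp: supp_map_def)
qed

text \<open>The L-relation gives both inclusions of images. The R-relation does the same for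
  supports unless a constant occurs, and then equal images already force f = g.\<close>

lemma green_H_imp_Im_supp:
  assumes "f \<in> normal_forms n" "g \<in> normal_forms n" "(f, g) \<in> H_rel n"
  shows "Im_map n f = Im_map n g \<and> supp_map n f = supp_map n g"
proof -
  have L: "f = g \<or> (\<exists>s\<in>normal_forms n. \<exists>t\<in>normal_forms n. f = bmap_comp n s g \<and> g = bmap_comp n t f)"
    and R: "f = g \<or> (\<exists>s\<in>normal_forms n. \<exists>t\<in>normal_forms n. f = bmap_comp n g s \<and> g = bmap_comp n f t)"
    using assms green_affine_iff[OF assms(1,2)] by (auto simp: green_H_def)
  have Im: "Im_map n f = Im_map n g"
    using L Im_map_comp normal_forms_maps by (metis subset_antisym)
  show ?thesis
  proof (cases "\<exists>c. f = const_map n c \<or> g = const_map n c")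
    case True
    then have "f = g" using Im assms normal_form_extensional Im_singleton_imp_eq
      by (metis Im_supp_simps(1))
    then show ?thesis by simp
  next
    case False
    then show ?thesis using Im R right_multiple_supp assms(1,2) by (metis subset_antisym)
  qed
qed

section \<open>From equal image and support to the relation H\<close>

lemma column_map_cong:
  "(\<And>i. i \<in> {1..n} \<Longrightarrow> \<sigma> i = \<tau> i) \<Longrightarrow> column_map n k p \<sigma> = column_map n k p \<tau>"
  by (rule bmap_eqI[where n = n]) auto

text \<open>Solve \<sigma> = \<tau> \<circ> \<rho> for a permutation \<rho>; the left factor gets
  both indices k, so that it maps column k to itself.\<close>

lemma column_left_multiple:
  assumes "k \<in> {1..n}" "p \<in> {1..n}" "bij_betw \<sigma> {1..n} {1..n}" "bij_betw \<tau> {1..n} {1..n}"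
  shows "\<exists>s\<in>normal_forms n. column_map n k p \<sigma> = bmap_comp n s (column_map n k p \<tau>)"
proof
  let ?\<rho> = "inv_into {1..n} \<tau> \<circ> \<sigma>"
  have \<rho>: "bij_betw ?\<rho> {1..n} {1..n}"
    using assms bij_betw_inv_into bij_betw_trans by blast
  then show "column_map n k k ?\<rho> \<in> normal_forms n" using assms by (auto intro: normal_forms.column)
  have "\<sigma> i = (\<tau> \<circ> ?\<rho>) i" if "i \<in> {1..n}" for i
    using bij_betw_inv_into_right[OF assms(4) bij_betw_apply[OF assms(3) that]] by simp
  then have "column_map n k p \<sigma> = column_map n k p (\<tau> \<circ> ?\<rho>)"
    by (rule column_map_cong)
  also have "\<dots> = bmap_comp n (column_map n k k ?\<rho>) (column_map n k p \<tau>)"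
    using \<rho> assms(1) by (subst column_comp_column) (auto simp: bij_betw_def)
  finally show "column_map n k p \<sigma> = bmap_comp n (column_map n k k ?\<rho>) (column_map n k p \<tau>)" .
qed

text \<open>Dually, solve \<sigma> = \<rho> \<circ> \<tau>; the right factor acts on column p, where
  the given map takes its nonzero values.\<close>

lemma column_right_multiple:
  assumes "k \<in> {1..n}" "p \<in> {1..n}" "bij_betw \<sigma> {1..n} {1..n}" "bij_betw \<tau> {1..n} {1..n}"
  shows "\<exists>s\<in>normal_forms n. column_map n k p \<sigma> = bmap_comp n (column_map n k p \<tau>) s"
proof
  let ?\<rho> = "\<sigma> \<circ> inv_into {1..n} \<tau>"
  have \<rho>: "bij_betw ?\<rho> {1..n} {1..n}"
    using assms bij_betw_inv_into bij_betw_trans by blast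
  then show "column_map n p p ?\<rho> \<in> normal_forms n" using assms by (auto intro: normal_forms.column)
  have "\<sigma> i = (?\<rho> \<circ> \<tau>) i" if "i \<in> {1..n}" for i
    using that assms by (simp add: bij_betw_inv_into_left)
  then have "column_map n k p \<sigma> = column_map n k p (?\<rho> \<circ> \<tau>)"
    by (rule column_map_cong)
  also have "\<dots> = bmap_comp n (column_map n k p \<tau>) (column_map n p p ?\<rho>)"
    using assms by (subst column_comp_column) (auto simp: bij_betw_def)
  finally show "column_map n k p \<sigma> = bmap_comp n (column_map n k p \<tau>) (column_map n p p ?\<rho>)" .
qed

text \<open>The element (k, k) of column k reveals the index. The first form serves supports, the
  second images.\<close>

lemma column_index_eq:
  assumes "k \<in> {1..n}"
  shows "(\<lambda>i. Pair_elem i k) ` {1..n} = (\<lambda>i. Pair_elem i k') ` {1..n} \<longleftrightarrow> k = k'"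
    "insert \<vartheta> ((\<lambda>i. Pair_elem i k) ` {1..n}) = insert \<vartheta> ((\<lambda>i. Pair_elem i k') ` {1..n}) \<longleftrightarrow> k = k'"
proof -
  have 1: "(\<lambda>i. Pair_elem i k) ` {1..n} = (\<lambda>i. Pair_elem i k') ` {1..n} \<longleftrightarrow> k = k'" for k'
  proof
    assume "(\<lambda>i. Pair_elem i k) ` {1..n} = (\<lambda>i. Pair_elem i k') ` {1..n}"
    then have "Pair_elem k k \<in> (\<lambda>i. Pair_elem i k') ` {1..n}" using assms by blast
    then show "k = k'" by auto
  qed simp
  show "(\<lambda>i. Pair_elem i k) ` {1..n} = (\<lambda>i. Pair_elem i k') ` {1..n} \<longleftrightarrow> k = k'" by (rule 1)
  show "insert \<vartheta> ((\<lambda>i. Pair_elem i k) ` {1..n}) = insert \<vartheta> ((\<lambda>i. Pair_elem i k') ` {1..n}) \<longleftrightarrow> k = k'"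
    using 1[of k'] insert_ident[of \<vartheta> "(\<lambda>i. Pair_elem i k) ` {1..n}" "(\<lambda>i. Pair_elem i k') ` {1..n}"]
    by blast
qed

text \<open>If a constant or a point map occurs, the invariants force f = g. Otherwise they give two
  column maps the same k and p, and such maps divide each other on both sides.\<close>

lemma Im_supp_imp_green_H:
  assumes fg: "f \<in> normal_forms n" "g \<in> normal_forms n"
    and Im: "Im_map n f = Im_map n g" and supp: "supp_map n f = supp_map n g"
  shows "(f, g) \<in> H_rel n"
proof -
  note ext = fg[THEN normal_form_extensional]
  have const: "f = g" if "f = const_map n c \<or> g = const_map n c" for c
    using that Im ext Im_singleton_imp_eq by (metis Im_supp_simps(1))
  have point: "f = g" if "f = point_map n \<alpha> \<beta> \<or> g = point_map n \<alpha> \<beta>" "\<alpha> \<in> pairs n" "\<beta> \<in> pairs n"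
    for \<alpha> \<beta> using that Im supp ext point_map_unique Im_supp_point by metis
  have "f = g \<or> (\<exists>k p \<sigma> \<tau>. k \<in> {1..n} \<and> p \<in> {1..n} \<and> bij_betw \<sigma> {1..n} {1..n} \<and>
      bij_betw \<tau> {1..n} {1..n} \<and> f = column_map n k p \<sigma> \<and> g = column_map n k p \<tau>)"
    using fg(1)
  proof cases
    case f: (column k p \<sigma>)
    show ?thesis using fg(2)
    proof cases
      case g: (column k' p' \<tau>)
      have "k = k'" "p = p'"
        using Im supp f g column_index_eq[of k n k'] column_index_eq[of p n p']
        by (simp_all add: Im_supp_column)
      then show ?thesis using f g by blast
    qed (use const point in blast)+
  qed (use const point in blast)+
  then show ?thesis
  proof
    assume "f = g"
    then show ?thesis using green_affine_iff[OF fg] by (simp add: green_H_def)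
  next
    assume "\<exists>k p \<sigma> \<tau>. k \<in> {1..n} \<and> p \<in> {1..n} \<and> bij_betw \<sigma> {1..n} {1..n} \<and>
      bij_betw \<tau> {1..n} {1..n} \<and> f = column_map n k p \<sigma> \<and> g = column_map n k p \<tau>"
    then obtain k p \<sigma> \<tau> where *: "k \<in> {1..n}" "p \<in> {1..n}" "bij_betw \<sigma> {1..n} {1..n}"
      "bij_betw \<tau> {1..n} {1..n}" "f = column_map n k p \<sigma>" "g = column_map n k p \<tau>" by blast
    have "\<exists>s\<in>normal_forms n. f = bmap_comp n s g" "\<exists>s\<in>normal_forms n. g = bmap_comp n s f"
      "\<exists>s\<in>normal_forms n. f = bmap_comp n g s" "\<exists>s\<in>normal_forms n. g = bmap_comp n f s"
      unfolding *(5,6) using *(1-4) by (intro column_left_multiple column_right_multiple; simp)+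
    then show ?thesis
      using green_affine_iff[OF fg] unfolding green_H_def by blast
  qed
qed


section \<open>Counting the classes\<close>

text \<open>The classes are the nonempty fibres of \<phi>, and distinct values have distinct
  fibres.\<close>

lemma card_quotient_kernel:
  assumes "r \<subseteq> S \<times> S" "\<And>a b. a \<in> S \<Longrightarrow> b \<in> S \<Longrightarrow> (a, b) \<in> r \<longleftrightarrow> \<phi> a = \<phi> b"
  shows "card (S // r) = card (\<phi> ` S)"
proof -
  have "r `` {a} = {b \<in> S. \<phi> b = \<phi> a}" if "a \<in> S" for a
    using that assms by (auto simp: Image_def)
  then have "S // r = (\<lambda>c. {b \<in> S. \<phi> b = c}) ` \<phi> ` S"
    by (auto simp: quotient_def image_iff)
  moreover have "inj_on (\<lambda>c. {b \<in> S. \<phi> b = c}) (\<phi> ` S)"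
    by (auto simp: inj_on_def)
  ultimately show ?thesis by (simp add: card_image)
qed

lemma pairs_eq_image: "pairs n = case_prod Pair_elem ` ({1..n} \<times> {1..n})"
  by (auto simp: pairs_def brandt_def)

lemma finite_pairs [simp]: "finite (pairs n)"
  by (simp add: pairs_eq_image)

lemma card_pairs: "card (pairs n) = n ^ 2"
  unfolding pairs_eq_image
  by (subst card_image) (auto simp: inj_on_def card_cartesian_product power2_eq_square)

lemma brandt_eq_insert: "brandt n = insert \<vartheta> (pairs n)"
  by (auto simp: pairs_def)

text \<open>The values split into those of the constants (\<open>A\<close>), of the points
  (\<open>B\<close>) and of the column maps (\<open>C\<close>), contributing n^2 + 1, n^4 and
  n^2.\<close>

lemma card_Im_supp:
  assumes "n \<ge> 2"
  shows "card ((\<lambda>f. (Im_map n f, supp_map n f)) ` normal_forms n) = n ^ 4 + 2 * n ^ 2 + 1"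
proof -
  define A where "A = (\<lambda>c. ({c}, if c = \<vartheta> then {} else brandt n)) ` brandt n"
  define B where "B = (\<lambda>(\<alpha>, \<beta>). ({\<vartheta>, \<beta>}, {\<alpha>})) ` (pairs n \<times> pairs n)"
  define col where "col k = (\<lambda>i. Pair_elem i k) ` {1..n}" for k
  define C where "C = (\<lambda>(k, p). (insert \<vartheta> (col p), col k)) ` ({1..n} \<times> {1..n})"
  have "(\<lambda>f. (Im_map n f, supp_map n f)) ` normal_forms n = A \<union> B \<union> C" (is "?\<phi> ` _ = _")
  proof (intro equalityI subsetI)
    fix x assume "x \<in> ?\<phi> ` normal_forms n"
    then obtain f where f: "f \<in> normal_forms n" "x = ?\<phi> f" by blast
    from f(1) show "x \<in> A \<union> B \<union> C"
    proof cases
      case (const c)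
      then have "x \<in> A" using f(2) by (simp add: A_def)
      then show ?thesis by blast
    next
      case (point \<alpha> \<beta>)
      then have "x \<in> B" using f(2) by (auto simp: B_def Im_supp_point)
      then show ?thesis by blast
    next
      case (column k p \<sigma>)
      then have "x \<in> C" using f(2) by (auto simp: C_def Im_supp_column col_def)
      then show ?thesis by blast
    qed
  next
    fix x assume "x \<in> A \<union> B \<union> C"
    then consider "x \<in> A" | "x \<in> B" | "x \<in> C" by blast
    then show "x \<in> ?\<phi> ` normal_forms n"
    proof cases
      case 1
      then obtain c where "c \<in> brandt n" "x = ?\<phi> (const_map n c)" by (auto simp: A_def)
      then show ?thesis using normal_forms.const by blast
    next
      case 2
      then obtain \<alpha> \<beta> where "\<alpha> \<in> pairs n" "\<beta> \<in> pairs n" "x = ?\<phi> (point_map n \<alpha> \<beta>)"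
        by (auto simp: B_def Im_supp_point)
      then show ?thesis using normal_forms.point by blast
    next
      case 3
      then obtain k p where kp: "k \<in> {1..n}" "p \<in> {1..n}" "x = (insert \<vartheta> (col p), col k)"
        by (auto simp: C_def)
      \<comment> \<open>The invariants do not depend on the permutation, so the identity serves as
        representative.\<close>
      then have "x = ?\<phi> (column_map n k p id)"
        by (simp add: Im_supp_column col_def)
      moreover have "column_map n k p id \<in> normal_forms n"
        using kp by (simp add: normal_forms.column)
      ultimately show ?thesis by blast
    qed
  qed
  moreover have "card A = n ^ 2 + 1"
    unfolding A_def by (subst card_image) (auto simp: inj_on_def card_pairs brandt_eq_insert)
  moreover have "card B = n ^ 4"
    unfolding B_def
    by (subst card_image)
      (auto simp: inj_on_def card_cartesian_product card_pairs doubleton_eq_iff simp flip: power_add)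
  moreover have "card C = n ^ 2"
  proof -
    have "col k = col k' \<longleftrightarrow> k = k'" "insert \<vartheta> (col k) = insert \<vartheta> (col k') \<longleftrightarrow> k = k'"
      if "k \<in> {1..n}" for k k'
      using column_index_eq[OF that] by (simp_all add: col_def)
    then have "inj_on (\<lambda>(k, p). (insert \<vartheta> (col p), col k)) ({1..n} \<times> {1..n})"
      by (auto simp: inj_on_def)
    then show ?thesis
      unfolding C_def by (simp add: card_image card_cartesian_product power2_eq_square)
  qed
  \<comment> \<open>First components differ: a singleton against {\<vartheta>, \<beta>} with \<beta>
    nonzero.\<close>
  moreover have "A \<inter> B = {}"
    using pairs_nonTheta by (fastforce simp: A_def B_def)
  moreover have "(A \<union> B) \<inter> C = {}"
  proof -
    \<comment> \<open>Here n \<ge> 2 enters: a column has two distinct elements, so it is not the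
      support of a point map; lacking \<vartheta>, it is not that of a nonzero constant
      either.\<close>
    have "\<vartheta> \<notin> col k" "Pair_elem 1 k \<in> col k" "Pair_elem 2 k \<in> col k" for k
      using assms by (auto simp: col_def)
    then have "col k \<noteq> {}" "col k \<noteq> brandt n" "col k \<noteq> {\<alpha>}" for k \<alpha>
      by (auto, metis Theta_in_brandt, metis singletonD brandt_elem.inject one_eq_numeral_iff semiring_norm(85))
    then show ?thesis by (fastforce simp: A_def B_def C_def)
  qed
  moreover have "finite A" "finite B" "finite C"
    by (auto simp: A_def B_def C_def brandt_eq_insert)
  ultimately show ?thesis by (simp add: card_Un_disjoint)
qed

theorem corollary4p6:
  fixes n :: nat
  assumes "n \<ge> 1"
  shows "(\<forall>f\<in>affine_nsr n. \<forall>g\<in>affine_nsr n.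
            (f, g) \<in> H_rel n \<longleftrightarrow> Im_map n f = Im_map n g \<and> supp_map n f = supp_map n g)
         \<and> (n \<ge> 2 \<longrightarrow> card (affine_nsr n // H_rel n) = n ^ 4 + 2 * n ^ 2 + 1)"
proof -
  have iff: "(f, g) \<in> H_rel n \<longleftrightarrow> Im_map n f = Im_map n g \<and> supp_map n f = supp_map n g"
    if "f \<in> affine_nsr n" "g \<in> affine_nsr n" for f g
    using that green_H_imp_Im_supp Im_supp_imp_green_H unfolding affine_nsr_eq_normal_forms by blast
  \<comment> \<open>By the equivalence just shown, H is the kernel of the pair of invariants, so
    counting classes means counting values.\<close>
  moreover have "card (affine_nsr n // H_rel n)
      = card ((\<lambda>f. (Im_map n f, supp_map n f)) ` affine_nsr n)"
  proof (rule card_quotient_kernel)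
    show "H_rel n \<subseteq> affine_nsr n \<times> affine_nsr n" by (auto simp: green_H_def green_L_def)
  qed (simp add: iff)
  ultimately show ?thesis using card_Im_supp unfolding affine_nsr_eq_normal_forms by auto
qed

end
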